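(* If $f\in\mathcal{S}^*_{SG}$, then $f\in\Omega$ in the disc $|z|<r_0$, i.e. $|zf'(z)-f(z)|<\frac12$ for all $|z|<r_0$, where $r_0\approx0.799269$ is the smallest positive root of $2\tan(r/2)f_0(r)-1=0$ and $$f_0(z)=z\exp\left(\int_0^z\frac{e^t-1}{t(e^t+1)}\,dt\right)=z+\frac{z^2}{2}+\frac{z^3}{8}+\frac{z^4}{144}-\frac{5z^5}{1152}+\cdots.$$
   Context: $\mathbb{D}=\{z\in\mathbb{C}:|z|<1\}$. $\mathcal{A}$ is the class of analytic functions $f$ on $\mathbb{D}$ with $f(0)=0$, $f'(0)=1$. $\Omega=\{f\in\mathcal{A}:|zf'(z)-f(z)|<\frac12,\ z\in\mathbb{D}\}$; "$f\in\Omega$ in the disc $|z|<r_0$" means that the defining inequality holds for all $|z|<r_0$. $\mathcal{S}^*_{SG}$ is the class of $f\in\mathcal{A}$ with $zf'(z)/f(z)\prec 2/(1+e^{-z})$, where $p\prec\phi$ means $p=\phi\circ\omega$ for some analytic $\omega:\mathbb{D}\to\mathbb{D}$ with $\omega(0)=0$. *)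

theory Defs
  imports "HOL-Complex_Analysis.Complex_Analysis"
begin

abbreviation unit_disc :: "complex set" where
  "unit_disc \<equiv> ball 0 1"

definition class_A :: "(complex \<Rightarrow> complex) set" where
  "class_A = {f. f holomorphic_on unit_disc \<and> f 0 = 0 \<and> deriv f 0 = 1}"

definition subordinate :: "(complex \<Rightarrow> complex) \<Rightarrow> (complex \<Rightarrow> complex) \<Rightarrow> bool" where
  "subordinate p \<phi> \<longleftrightarrow>
     (\<exists>\<omega>. \<omega> holomorphic_on unit_disc \<and> \<omega> ` unit_disc \<subseteq> unit_disc \<and> \<omega> 0 = 0 \<and>
          (\<forall>z\<in>unit_disc. p z = \<phi> (\<omega> z)))"

text \<open>The quotient \<open>z f'(z) / f(z)\<close>. For \<open>f\<close> in the class \<open>class_A\<close> it has a removable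
  singularity at the origin with limit 1, which is filled in explicitly.\<close>
definition starlike_quotient :: "(complex \<Rightarrow> complex) \<Rightarrow> complex \<Rightarrow> complex" where
  "starlike_quotient f z = (if z = 0 then 1 else z * deriv f z / f z)"

definition sigmoid :: "complex \<Rightarrow> complex" where
  "sigmoid z = 2 / (1 + exp (- z))"

text \<open>The subordination forces \<open>f z \<noteq> 0\<close> on the punctured disc: \<open>sigmoid\<close> does not vanish on
  the unit disc, whereas the quotient would be 0 at a zero of \<open>f\<close>, since division by 0 gives 0.\<close>
definition class_S_SG :: "(complex \<Rightarrow> complex) set" where
  "class_S_SG = {f \<in> class_A. subordinate (starlike_quotient f) sigmoid}"

definition in_Omega_disc :: "(complex \<Rightarrow> complex) \<Rightarrow> real \<Rightarrow> bool" where
  "in_Omega_disc f r \<longleftrightarrow> (\<forall>z. norm z < r \<longrightarrow> norm (z * deriv f z - f z) < 1 / 2)"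

text \<open>The integral is taken along the segment from 0 to \<open>z\<close>. The integrand has a removable
  singularity at 0 and its value at that single point does not affect the integral.\<close>
definition f0 :: "complex \<Rightarrow> complex" where
  "f0 z = z * exp (contour_integral (linepath 0 z) (\<lambda>t. (exp t - 1) / (t * (exp t + 1))))"

definition smallest_positive_root :: "(real \<Rightarrow> complex) \<Rightarrow> real \<Rightarrow> bool" where
  "smallest_positive_root g r \<longleftrightarrow> 0 < r \<and> g r = 0 \<and> (\<forall>s. 0 < s \<and> s < r \<longrightarrow> g s \<noteq> 0)"

end

theory Submission
  imports Defs
begin

text \<open>
  Since \<open>sigmoid z - 1 = tanh (z / 2)\<close>, the quantity \<open>z f'(z) - f(z)\<close> equals
  \<open>f(z) tanh (\<omega>(z) / 2)\<close>, where \<open>\<bar>\<omega>(z)\<bar> \<le> \<bar>z\<bar>\<close> by the Schwarz lemma. On \<open>\<bar>w\<bar> \<le> r < 1\<close> the modulus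
  of \<open>tanh (w / 2)\<close> is largest at \<open>w = \<i>r\<close>, with value \<open>tan (r / 2)\<close>, and its real part is largest
  at \<open>w = r\<close>. Integrating the latter bound for the logarithmic derivative of \<open>f(z) / z\<close> along the
  radius gives \<open>\<bar>f(z)\<bar> \<le> f0(\<bar>z\<bar>)\<close>. So \<open>\<bar>z f'(z) - f(z)\<bar> \<le> tan (r / 2) f0(r)\<close> with \<open>r = \<bar>z\<bar>\<close>, and
  the right-hand side is strictly increasing in \<open>r\<close>. The root is located by integrating
  Taylor bounds for \<open>tanh\<close>, obtained from the Riccati equation \<open>tanh' = 1 - tanh\<^sup>2\<close>.
\<close>

subsection \<open>Extremal values of the sigmoid function on discs\<close>

lemma sinh_le_mult_cosh:
  fixes x :: real
  assumes "0 \<le> x"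
  shows "sinh x \<le> x * cosh x"
proof -
  have "0 * cosh 0 - sinh 0 \<le> x * cosh x - sinh x"
  proof (rule DERIV_nonneg_imp_nondecreasing[OF assms])
    fix t :: real assume "0 \<le> t" "t \<le> x"
    have "((\<lambda>x. x * cosh x - sinh x) has_real_derivative t * sinh t) (at t)"
      by (auto intro!: derivative_eq_intros)
    thus "\<exists>y. ((\<lambda>x. x * cosh x - sinh x) has_real_derivative y) (at t) \<and> 0 \<le> y"
      using \<open>0 \<le> t\<close> by (intro exI[of _ "t * sinh t"]) auto
  qed
  thus ?thesis by simp
qed

lemma mult_cos_le_sin:
  fixes x :: real
  assumes "0 \<le> x" "x \<le> pi"
  shows "x * cos x \<le> sin x"
proof -
  have "sin 0 - 0 * cos 0 \<le> sin x - x * cos x"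
  proof (rule DERIV_nonneg_imp_nondecreasing[OF assms(1)])
    fix t :: real assume "0 \<le> t" "t \<le> x"
    have "((\<lambda>x. sin x - x * cos x) has_real_derivative t * sin t) (at t)"
      by (auto intro!: derivative_eq_intros)
    thus "\<exists>y. ((\<lambda>x. sin x - x * cos x) has_real_derivative y) (at t) \<and> 0 \<le> y"
      using \<open>0 \<le> t\<close> \<open>t \<le> x\<close> assms by (intro exI[of _ "t * sin t"]) (auto intro!: mult_nonneg_nonneg sin_ge_zero)
  qed
  thus ?thesis by simp
qed

text \<open>With \<open>y\<close> fixed, \<open>cos (sqrt (t^2 + y^2)) * cosh t\<close> decreases in
  \<open>t\<close>: the sign of its derivative comes from \<open>tanh t / t\<close> being at most 1
  and \<open>tan r / r\<close> at least 1, in the division-free forms just proved. At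
  \<open>t = 0\<close> the value is \<open>cos y\<close>. So on a circle of radius at most 1,
  \<open>cos y / cosh x\<close> is smallest on the imaginary axis.\<close>

lemma cos_mult_cosh_le:
  fixes x y :: real
  assumes "x\<^sup>2 + y\<^sup>2 \<le> 1"
  shows "cos (sqrt (x\<^sup>2 + y\<^sup>2)) * cosh x \<le> cos y"
proof -
  let ?h = "\<lambda>t. sqrt (t\<^sup>2 + y\<^sup>2)"
  let ?g = "\<lambda>t. cos (?h t) * cosh t"
  have "?g \<bar>x\<bar> \<le> ?g 0"
  proof (rule DERIV_nonpos_imp_decreasing_open[of 0 "\<bar>x\<bar>" ?g])
    show "continuous_on {0..\<bar>x\<bar>} ?g" by (intro continuous_intros)
    fix t assume t: "0 < t" "t < \<bar>x\<bar>"
    have pos: "0 < t\<^sup>2 + y\<^sup>2" using t by (simp add: add_pos_nonneg)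
    define r where "r = ?h t"
    have r: "0 < r" using pos by (simp add: r_def)
    have "t\<^sup>2 \<le> x\<^sup>2" using t by (simp add: abs_le_square_iff[symmetric])
    hence "r \<le> 1" unfolding r_def using assms by (simp add: real_le_lsqrt)
    hence rpi: "r < pi / 2" using pi_half_gt_zero pi_gt3 by linarith
    have D: "(?g has_real_derivative cos r * sinh t - sin r * (t / r) * cosh t) (at t)"
      unfolding r_def using pos
      by (auto intro!: derivative_eq_intros simp: field_simps)
    have "cos r * sinh t \<le> cos r * (t * cosh t)"
      using r rpi t by (intro mult_left_mono sinh_le_mult_cosh cos_ge_zero) auto
    also have "\<dots> = (r * cos r) * (t / r * cosh t)" using r by simp
    also have "\<dots> \<le> sin r * (t / r * cosh t)"
      using r rpi t by (intro mult_right_mono mult_cos_le_sin) auto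
    finally show "\<exists>d. (?g has_real_derivative d) (at t) \<and> d \<le> 0"
      using D by (intro exI[of _ "cos r * sinh t - sin r * (t / r) * cosh t"]) (simp add: algebra_simps)
  qed auto
  moreover have "cos \<bar>y\<bar> = cos y" by (auto simp: abs_if)
  ultimately show ?thesis by (auto simp: real_sqrt_abs)
qed

lemma tanh_half_eq_real:
  fixes x :: real
  shows "tanh (x / 2) = sinh x / (cosh x + 1)"
proof -
  have "sinh x = 2 * sinh (x/2) * cosh (x/2)" using sinh_double[of "x/2"] by simp
  moreover have "cosh x = 2 * cosh (x/2) ^ 2 - 1" using cosh_double_cosh[of "x/2"] by simp
  moreover have "cosh (x/2) \<noteq> 0" by simp
  ultimately show ?thesis by (simp add: tanh_def power2_eq_square)
qed

lemma tan_half_square: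
  fixes x :: real
  assumes "cos (x / 2) \<noteq> 0"
  shows "(tan (x / 2))\<^sup>2 = (1 - cos x) / (1 + cos x)"
proof -
  have "cos x = 2 * (cos (x/2))\<^sup>2 - 1" using cos_double_cos[of "x/2"] by simp
  moreover from this have "1 - cos x = 2 * (sin (x/2))\<^sup>2" by (simp add: sin_squared_eq)
  ultimately show ?thesis using assms by (simp add: tan_def power_divide)
qed

text \<open>This is the splitting of \<open>tanh (w / 2)\<close> into real and imaginary part. It is
  checked by multiplying out with the denominator \<open>1 + exp (- w)\<close>.\<close>

lemma sigmoid_minus_one_Complex:
  assumes "cosh x + cos y \<noteq> 0"
  shows "sigmoid (Complex x y) - 1 = Complex (sinh x / (cosh x + cos y)) (sin y / (cosh x + cos y))"
proof -
  define d where "d = cosh x + cos y"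
  have e: "exp (- Complex x y) = Complex (exp (-x) * cos y) (- (exp (-x) * sin y))"
    by (simp add: complex_eq_iff Re_exp Im_exp)
  have sc: "(sin y)\<^sup>2 = 1 - (cos y)\<^sup>2" by (rule sin_squared_eq)
  \<comment> \<open>The left side is the squared modulus of \<open>1 + exp (- Complex x y)\<close>,
    so \<open>d \<noteq> 0\<close> keeps this denominator away from 0.\<close>
  have ne: "(1 + exp (-x) * cos y)\<^sup>2 + (exp (-x) * sin y)\<^sup>2 = 2 * exp (-x) * d"
  proof -
    have "(1 + exp (-x) * cos y)\<^sup>2 + (exp (-x) * sin y)\<^sup>2 = 1 + 2 * exp (-x) * cos y + (exp (-x))\<^sup>2"
      unfolding power_mult_distrib power2_sum sc by (simp add: algebra_simps)
    also have "\<dots> = exp (-x) * exp x + 2 * exp (-x) * cos y + (exp (-x))\<^sup>2"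
      by (simp add: exp_minus)
    also have "\<dots> = 2 * exp (-x) * d"
      by (simp add: d_def cosh_def algebra_simps power2_eq_square)
    finally show ?thesis .
  qed
  have nz: "1 + exp (- Complex x y) \<noteq> 0"
  proof
    assume "1 + exp (- Complex x y) = 0"
    hence "1 + exp (-x) * cos y = 0" "exp (-x) * sin y = 0" unfolding e by (auto simp: complex_eq_iff)
    hence "2 * exp (-x) * d = 0" using ne by simp
    thus False using assms by (simp add: d_def)
  qed
  have "2 = (Complex (sinh x / d) (sin y / d) + 1) * (1 + exp (- Complex x y))"
  proof (rule complex_eqI)
    define E where "E = exp (-x)"
    have E: "E = cosh x - sinh x" and E1: "(cosh x + sinh x) * E = 1"
      by (simp_all add: E_def cosh_minus_sinh cosh_plus_sinh exp_minus)
    have d: "d \<noteq> 0" using assms d_def by simp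
    have "(sinh x + d) * (1 + E * cos y) + sin y * (E * sin y) =
        sinh x + d + (cosh x + sinh x) * E * cos y + (E * (sin y)\<^sup>2 + E * (cos y)\<^sup>2)"
      by (simp add: d_def algebra_simps power2_eq_square)
    also have "\<dots> = 2 * d" unfolding E1 distrib_left[symmetric] sin_cos_squared_add by (simp add: E d_def)
    finally have re: "(sinh x + d) * (1 + E * cos y) + sin y * (E * sin y) = 2 * d" .
    thus "Re 2 = Re ((Complex (sinh x / d) (sin y / d) + 1) * (1 + exp (- Complex x y)))"
      unfolding e E_def[symmetric] using d by (simp add: field_simps)
    have "sin y * (1 + E * cos y) - (sinh x + d) * (E * sin y) =
        sin y * (1 - (cosh x + sinh x) * E)"
      by (simp add: d_def algebra_simps)
    also have "\<dots> = 0" unfolding E1 by simp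
    finally show "Im 2 = Im ((Complex (sinh x / d) (sin y / d) + 1) * (1 + exp (- Complex x y)))"
      unfolding e E_def[symmetric] using d by (simp add: field_simps)
  qed
  thus ?thesis using nz by (simp add: sigmoid_def d_def field_simps)
qed

text \<open>The squared modulus is \<open>(cosh x - cos y) / (cosh x + cos y)\<close>, which
  decreases in the ratio \<open>cos y / cosh x\<close>. By \<open>cos_mult_cosh_le\<close> that
  ratio is at least \<open>cos \<rho>\<close>, and this value yields \<open>tan (\<rho> / 2)\<close>
  squared.\<close>

lemma norm_sigmoid_minus_one_le:
  assumes "norm w \<le> r" "r < 1"
  shows "norm (sigmoid w - 1) \<le> tan (r / 2)"
proof -
  obtain x y where w: "w = Complex x y" by (cases w)
  define \<rho> where "\<rho> = norm w"
  have \<rho>: "\<rho> = sqrt (x\<^sup>2 + y\<^sup>2)" "0 \<le> \<rho>" "\<rho> < 1" "\<rho> \<le> r"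
    using assms by (auto simp: \<rho>_def) (simp add: w complex_norm)
  have "x\<^sup>2 + y\<^sup>2 \<le> 1" using \<rho> by (metis less_eq_real_def real_sqrt_lt_1_iff)
  hence key: "cos \<rho> * cosh x \<le> cos y" using cos_mult_cosh_le \<rho>(1) by simp
  have p3: "3 < pi" by (rule pi_gt3)
  have c\<rho>: "0 < cos \<rho>" using \<rho>(2,3) p3 by (intro cos_gt_zero_pi) linarith+
  have d: "0 < cosh x + cos y"
    by (metis add_pos_pos c\<rho> cosh_real_pos key less_le_trans mult_pos_pos)
  have "(norm (sigmoid w - 1))\<^sup>2 = ((sinh x)\<^sup>2 + (sin y)\<^sup>2) / (cosh x + cos y)\<^sup>2"
    using d by (simp add: w sigmoid_minus_one_Complex cmod_power2 power_divide add_divide_distrib)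
  also have "(sinh x)\<^sup>2 + (sin y)\<^sup>2 = (cosh x - cos y) * (cosh x + cos y)"
    unfolding sinh_square_eq sin_squared_eq by (simp add: algebra_simps power2_eq_square)
  also have "\<dots> / (cosh x + cos y)\<^sup>2 = (cosh x - cos y) / (cosh x + cos y)"
    using d by (simp add: power2_eq_square)
  \<comment> \<open>After cross-multiplication this is exactly \<open>key\<close>.\<close>
  also have "\<dots> \<le> (1 - cos \<rho>) / (1 + cos \<rho>)"
    using d c\<rho> key by (simp add: divide_le_eq le_divide_eq field_simps)
  also have "\<dots> = (tan (\<rho> / 2))\<^sup>2"
    using \<rho>(2,3) p3 cos_gt_zero_pi[of "\<rho> / 2"] by (subst tan_half_square) auto
  finally have "norm (sigmoid w - 1) \<le> \<bar>tan (\<rho> / 2)\<bar>"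
    by (simp add: abs_le_square_iff[symmetric])
  also have "\<dots> \<le> tan (r / 2)"
  proof -
    have "0 \<le> tan (\<rho>/2)" using \<rho>(2,3) p3 by (intro tan_pos_pi2_le) auto
    moreover have "tan (\<rho>/2) \<le> tan (r/2)"
      using \<rho>(2-) p3 assms by (intro tan_mono_le) auto
    ultimately show ?thesis by simp
  qed
  finally show ?thesis .
qed

text \<open>On the circle of radius \<open>\<rho>\<close>, the bound \<open>1 - y^2 / 2\<close> for
  \<open>cos y\<close> with \<open>y^2 = \<rho>^2 - x^2\<close> leaves a function of
  \<open>x\<close> alone. For positive \<open>x\<close> it increases up to
  \<open>x = \<rho>\<close>, where it equals \<open>tanh (\<rho> / 2)\<close>; for the other
  \<open>x\<close> the real part is not positive.\<close>

lemma Re_sigmoid_minus_one_le: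
  assumes "norm w \<le> r" "r < 1"
  shows "Re (sigmoid w - 1) \<le> tanh (r / 2)"
proof -
  obtain x y where w: "w = Complex x y" by (cases w)
  define \<rho> where "\<rho> = norm w"
  have \<rho>: "\<rho>\<^sup>2 = x\<^sup>2 + y\<^sup>2" "0 \<le> \<rho>" "\<rho> < 1" "\<rho> \<le> r"
    using assms by (auto simp: \<rho>_def) (simp add: w cmod_power2)
  have x\<rho>: "\<bar>x\<bar> \<le> \<rho>" using abs_Re_le_cmod[of w] by (simp add: \<rho>_def w)
  have cy: "1 - (\<rho>\<^sup>2 - x\<^sup>2) / 2 \<le> cos y"
  proof -
    have "1 - cos y = 2 * (sin (y/2))\<^sup>2" using cos_double_sin[of "y/2"] by simp
    also have "(sin (y/2))\<^sup>2 \<le> (y/2)\<^sup>2"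
      using abs_sin_x_le_abs_x[of "y/2"] by (simp only: abs_le_square_iff)
    finally show ?thesis using \<rho> by (simp add: power_divide)
  qed
  have lt1: "\<rho>\<^sup>2 < 1" using \<rho>(2,3) by (simp add: abs_square_less_1)
  have aux: "0 < c + 1 - q / 2" if "1 \<le> c" "q < 1" for c q :: real
    using that by linarith
  have pos: "0 < cosh t + 1 - (\<rho>\<^sup>2 - t\<^sup>2) / 2" for t
    by (rule aux[OF cosh_real_ge_1 le_less_trans[OF _ lt1]]) simp
  have d: "0 < cosh x + 1 - (\<rho>\<^sup>2 - x\<^sup>2) / 2" by (rule pos)
  have d': "0 < cosh x + cos y" by (rule less_le_trans[OF d]) (use cy in simp)
  have "Re (sigmoid w - 1) = sinh x / (cosh x + cos y)"
    using d' by (simp add: w sigmoid_minus_one_Complex)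
  also have "\<dots> \<le> tanh (\<rho> / 2)"
  proof (cases "x \<le> 0")
    case True
    hence "sinh x / (cosh x + cos y) \<le> 0" using d' by (intro divide_nonpos_nonneg) auto
    also have "0 \<le> tanh (\<rho>/2)" using \<rho> by simp
    finally show ?thesis .
  next
    case False
    let ?h = "\<lambda>t. sinh t / (cosh t + 1 - (\<rho>\<^sup>2 - t\<^sup>2) / 2)"
    have "sinh x / (cosh x + cos y) \<le> ?h x"
      using d d' cy False by (intro divide_left_mono mult_pos_pos) auto
    also have "?h x \<le> ?h \<rho>"
    proof (rule DERIV_nonneg_imp_nondecreasing[of x \<rho> ?h])
      show "x \<le> \<rho>" using x\<rho> by simp
      fix t assume t: "x \<le> t" "t \<le> \<rho>"
      let ?N = "1 + cosh t * (1 - (\<rho>\<^sup>2 - t\<^sup>2) / 2) - t * sinh t"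
      have "((\<lambda>t. sinh t / (cosh t + 1 - (\<rho>\<^sup>2 - t\<^sup>2) / 2)) has_real_derivative
          (cosh t * (cosh t + 1 - (\<rho>\<^sup>2 - t\<^sup>2) / 2) - sinh t * (sinh t + t)) /
            (cosh t + 1 - (\<rho>\<^sup>2 - t\<^sup>2) / 2)\<^sup>2) (at t)"
        using pos[of t] by (auto intro!: derivative_eq_intros simp: power2_eq_square)
      also have "cosh t * (cosh t + 1 - (\<rho>\<^sup>2 - t\<^sup>2) / 2) - sinh t * (sinh t + t) = ?N"
        using hyperbolic_pythagoras[of t] by (simp add: algebra_simps power2_eq_square)
      finally have D: "(?h has_real_derivative ?N / (cosh t + 1 - (\<rho>\<^sup>2 - t\<^sup>2) / 2)\<^sup>2) (at t)" .
      have "t * sinh t \<le> t * cosh t"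
        using t False by (intro mult_left_mono) (auto simp: sinh_le_cosh_real)
      also have "\<dots> \<le> cosh t * (1 - (\<rho>\<^sup>2 - t\<^sup>2) / 2)"
      proof -
        \<comment> \<open>Half of this sum is \<open>1 - (\<rho>^2 - t^2) / 2 - t\<close>; here
          \<open>\<rho> < 1\<close> enters.\<close>
        have "0 \<le> (1 - t)\<^sup>2 + (1 - \<rho>\<^sup>2)" using lt1 by simp
        hence "t \<le> 1 - (\<rho>\<^sup>2 - t\<^sup>2) / 2" by (simp add: power2_diff field_simps)
        hence "cosh t * t \<le> cosh t * (1 - (\<rho>\<^sup>2 - t\<^sup>2) / 2)" by (intro mult_left_mono) auto
        thus ?thesis by (simp add: mult.commute)
      qed
      finally have "0 \<le> ?N" by simp
      thus "\<exists>d. (?h has_real_derivative d) (at t) \<and> 0 \<le> d" using D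
        by (intro exI[of _ "?N / (cosh t + 1 - (\<rho>\<^sup>2 - t\<^sup>2) / 2)\<^sup>2"]) auto
    qed
    also have "?h \<rho> = tanh (\<rho> / 2)" by (simp add: tanh_half_eq_real)
    finally show ?thesis .
  qed
  also have "\<dots> \<le> tanh (r / 2)" using \<rho> by simp
  finally show ?thesis .
qed

subsection \<open>Taylor bounds for the hyperbolic tangent\<close>

lemma tanh_artanh:
  fixes y :: real
  assumes "\<bar>y\<bar> < 1"
  shows "tanh (artanh y) = y"
proof -
  have pos: "0 < 1 + y" "0 < 1 - y" using assms by auto
  have "exp (- 2 * artanh y) = (1 - y) / (1 + y)"
    using pos by (simp add: artanh_def exp_minus)
  hence "tanh (artanh y) = (1 - (1 - y) / (1 + y)) / (1 + (1 - y) / (1 + y))"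
    unfolding tanh_real_altdef by simp
  also have "\<dots> = y" using pos by (simp add: divide_simps)
  finally show ?thesis .
qed

text \<open>A comparison principle for the Riccati equation: \<open>artanh\<close> straightens it,
  since \<open>artanh (L t) - t\<close> has derivative \<open>L' t / (1 - (L t)^2) - 1\<close>,
  which is at most 0, and starts at 0. The bound on \<open>L\<close> keeps it in the domain of
  \<open>artanh\<close>.\<close>

lemma le_tanh_of_deriv_le:
  fixes L L' :: "real \<Rightarrow> real"
  assumes "0 \<le> x" "L 0 = 0"
    and D: "\<And>t. 0 \<le> t \<Longrightarrow> t \<le> x \<Longrightarrow> (L has_real_derivative L' t) (at t)"
    and bd: "\<And>t. 0 \<le> t \<Longrightarrow> t \<le> x \<Longrightarrow> \<bar>L t\<bar> < 1"
    and le: "\<And>t. 0 \<le> t \<Longrightarrow> t \<le> x \<Longrightarrow> L' t \<le> 1 - (L t)\<^sup>2"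
  shows "L x \<le> tanh x"
proof -
  have "artanh (L x) - x \<le> artanh (L 0) - 0"
  proof (rule DERIV_nonpos_imp_nonincreasing[OF assms(1)])
    fix t assume t: "0 \<le> t" "t \<le> x"
    have "(L t)\<^sup>2 < 1" using bd[OF t] by (simp add: abs_square_less_1)
    hence "1 / (1 - (L t)\<^sup>2) * L' t - 1 \<le> 0" using le[OF t] by simp
    moreover have "((\<lambda>t. artanh (L t) - t) has_real_derivative 1 / (1 - (L t)\<^sup>2) * L' t - 1) (at t)"
      by (intro DERIV_diff DERIV_chain2[OF artanh_real_has_field_derivative] bd D t DERIV_ident)
    ultimately show "\<exists>y. ((\<lambda>t. artanh (L t) - t) has_real_derivative y) (at t) \<and> y \<le> 0" by blast
  qed
  hence "tanh (artanh (L x)) \<le> tanh x" using assms(2) by simp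
  thus ?thesis using bd[of x] assms(1) by (simp add: tanh_artanh)
qed

lemma tanh_le_of_le_deriv:
  fixes U U' :: "real \<Rightarrow> real"
  assumes "0 \<le> x" "U 0 = 0"
    and D: "\<And>t. 0 \<le> t \<Longrightarrow> t \<le> x \<Longrightarrow> (U has_real_derivative U' t) (at t)"
    and bd: "\<And>t. 0 \<le> t \<Longrightarrow> t \<le> x \<Longrightarrow> \<bar>U t\<bar> < 1"
    and le: "\<And>t. 0 \<le> t \<Longrightarrow> t \<le> x \<Longrightarrow> 1 - (U t)\<^sup>2 \<le> U' t"
  shows "tanh x \<le> U x"
proof -
  have "artanh (U 0) - 0 \<le> artanh (U x) - x"
  proof (rule DERIV_nonneg_imp_nondecreasing[OF assms(1)])
    fix t assume t: "0 \<le> t" "t \<le> x"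
    have "(U t)\<^sup>2 < 1" using bd[OF t] by (simp add: abs_square_less_1)
    hence "0 \<le> 1 / (1 - (U t)\<^sup>2) * U' t - 1" using le[OF t] by simp
    moreover have "((\<lambda>t. artanh (U t) - t) has_real_derivative 1 / (1 - (U t)\<^sup>2) * U' t - 1) (at t)"
      by (intro DERIV_diff DERIV_chain2[OF artanh_real_has_field_derivative] bd D t DERIV_ident)
    ultimately show "\<exists>y. ((\<lambda>t. artanh (U t) - t) has_real_derivative y) (at t) \<and> 0 \<le> y" by blast
  qed
  hence "tanh x \<le> tanh (artanh (U x))" using assms(2) by simp
  thus ?thesis using bd[of x] assms(1) by (simp add: tanh_artanh)
qed

text \<open>For Taylor polynomials \<open>P\<close> of \<open>tanh\<close>, the defect \<open>1 - P\<^sup>2 - P'\<close> in the Riccati equation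
  is a polynomial in \<open>t\<^sup>2\<close> with alternating coefficients, so its first one decides the sign.\<close>

lemma tanh_ge_Taylor7:
  fixes x :: real
  assumes "0 \<le> x" "x \<le> 1 / 2"
  shows "x - x ^ 3 / 3 + 2 * x ^ 5 / 15 - 17 * x ^ 7 / 315 \<le> tanh x"
proof (rule le_tanh_of_deriv_le[OF assms(1),
      where L = "\<lambda>x. x - x ^ 3 / 3 + 2 * x ^ 5 / 15 - 17 * x ^ 7 / 315"
        and L' = "\<lambda>x. 1 - x ^ 2 + 2 * x ^ 4 / 3 - 17 * x ^ 6 / 45"])
  fix t assume t: "0 \<le> t" "t \<le> x"
  define u where "u = t\<^sup>2"
  have u: "0 \<le> u" "u \<le> 1 / 4"
    using t assms power_mono[of t "1/2" 2] by (auto simp: u_def power2_eq_square)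
  show "((\<lambda>x. x - x ^ 3 / 3 + 2 * x ^ 5 / 15 - 17 * x ^ 7 / 315) has_real_derivative
      1 - t ^ 2 + 2 * t ^ 4 / 3 - 17 * t ^ 6 / 45) (at t)"
    by (auto intro!: derivative_eq_intros)
  \<comment> \<open>Factoring out \<open>t\<close> leaves a polynomial in \<open>u\<close> with
    values between 0 and 1, so the modulus is at most 1/2.\<close>
  have eq: "t - t ^ 3 / 3 + 2 * t ^ 5 / 15 - 17 * t ^ 7 / 315 =
      t * (1 - u / 3 + 2 * u ^ 2 / 15 - 17 * u ^ 3 / 315)"
    by (simp add: u_def algebra_simps power_numeral_reduce)
  have b: "0 \<le> 1 - u / 3 + 2 * u ^ 2 / 15 - 17 * u ^ 3 / 315"
          "1 - u / 3 + 2 * u ^ 2 / 15 - 17 * u ^ 3 / 315 \<le> 1"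
  proof -
    have "u ^ 2 \<le> u" "u ^ 3 \<le> u ^ 2" "0 \<le> u ^ 3"
      using u power_decreasing[of 1 2 u] power_decreasing[of 2 3 u] by auto
    thus "0 \<le> 1 - u / 3 + 2 * u ^ 2 / 15 - 17 * u ^ 3 / 315"
      "1 - u / 3 + 2 * u ^ 2 / 15 - 17 * u ^ 3 / 315 \<le> 1" using u by linarith+
  qed
  have "t * (1 - u / 3 + 2 * u ^ 2 / 15 - 17 * u ^ 3 / 315) \<le> 1 / 2 * 1"
    using b t assms by (intro mult_mono) auto
  moreover have "0 \<le> t * (1 - u / 3 + 2 * u ^ 2 / 15 - 17 * u ^ 3 / 315)"
    using b t by (intro mult_nonneg_nonneg)
  ultimately show "\<bar>t - t ^ 3 / 3 + 2 * t ^ 5 / 15 - 17 * t ^ 7 / 315\<bar> < 1"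
    unfolding eq by linarith
  \<comment> \<open>The leading coefficient 62/315 is that of \<open>t^8\<close> in the series of
    \<open>1 - tanh^2\<close>, the first term that the truncated derivative omits. Each negative
    term is paired with the preceding positive one, which dominates it for
    \<open>u \<le> 1 / 4\<close>.\<close>
  have "1 - (t - t ^ 3 / 3 + 2 * t ^ 5 / 15 - 17 * t ^ 7 / 315)\<^sup>2 -
      (1 - t ^ 2 + 2 * t ^ 4 / 3 - 17 * t ^ 6 / 45) =
      u ^ 4 * (62 / 315 - 254 / 4725 * u + u\<^sup>2 * (68 / 4725 - 289 / 99225 * u))"
    by (simp add: u_def field_simps power_numeral_reduce)
  also have "\<dots> \<ge> 0" using u by (intro mult_nonneg_nonneg add_nonneg_nonneg) auto
  finally show "1 - t ^ 2 + 2 * t ^ 4 / 3 - 17 * t ^ 6 / 45 \<le>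
      1 - (t - t ^ 3 / 3 + 2 * t ^ 5 / 15 - 17 * t ^ 7 / 315)\<^sup>2" by simp
qed auto

lemma tanh_le_Taylor9:
  fixes x :: real
  assumes "0 \<le> x" "x \<le> 1 / 2"
  shows "tanh x \<le> x - x ^ 3 / 3 + 2 * x ^ 5 / 15 - 17 * x ^ 7 / 315 + 62 * x ^ 9 / 2835"
proof (rule tanh_le_of_le_deriv[OF assms(1),
      where U = "\<lambda>x. x - x ^ 3 / 3 + 2 * x ^ 5 / 15 - 17 * x ^ 7 / 315 + 62 * x ^ 9 / 2835"
        and U' = "\<lambda>x. 1 - x ^ 2 + 2 * x ^ 4 / 3 - 17 * x ^ 6 / 45 + 62 * x ^ 8 / 315"])
  fix t assume t: "0 \<le> t" "t \<le> x"
  define u where "u = t\<^sup>2"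
  have u: "0 \<le> u" "u \<le> 1 / 4"
    using t assms power_mono[of t "1/2" 2] by (auto simp: u_def power2_eq_square)
  show "((\<lambda>x. x - x ^ 3 / 3 + 2 * x ^ 5 / 15 - 17 * x ^ 7 / 315 + 62 * x ^ 9 / 2835) has_real_derivative
      1 - t ^ 2 + 2 * t ^ 4 / 3 - 17 * t ^ 6 / 45 + 62 * t ^ 8 / 315) (at t)"
    by (auto intro!: derivative_eq_intros)
  define p where "p = 1 - u / 3 + 2 * u ^ 2 / 15 - 17 * u ^ 3 / 315 + 62 * u ^ 4 / 2835"
  have eq: "t - t ^ 3 / 3 + 2 * t ^ 5 / 15 - 17 * t ^ 7 / 315 + 62 * t ^ 9 / 2835 = t * p"
    by (simp add: u_def p_def algebra_simps power_numeral_reduce)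
  have p: "0 \<le> p" "p \<le> 1"
  proof -
    have "u ^ 2 \<le> u" "u ^ 3 \<le> u ^ 2" "0 \<le> u ^ 3" "0 \<le> u ^ 4" "u ^ 4 \<le> u ^ 3"
      using u power_decreasing[of 1 2 u] power_decreasing[of 2 3 u] power_decreasing[of 3 4 u] by auto
    thus "0 \<le> p" "p \<le> 1" unfolding p_def using u by linarith+
  qed
  show "\<bar>t - t ^ 3 / 3 + 2 * t ^ 5 / 15 - 17 * t ^ 7 / 315 + 62 * t ^ 9 / 2835\<bar> < 1"
    unfolding eq using p t assms mult_mono[of t "1/2" p 1] by (simp add: abs_mult)
  have "(1 - t ^ 2 + 2 * t ^ 4 / 3 - 17 * t ^ 6 / 45 + 62 * t ^ 8 / 315) -
      (1 - (t - t ^ 3 / 3 + 2 * t ^ 5 / 15 - 17 * t ^ 7 / 315 + 62 * t ^ 9 / 2835)\<^sup>2) =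
      u ^ 5 * (1382 / 14175 - 176 / 6075 * u + u\<^sup>2 * (2603 / 297675 - 2108 / 893025 * u)
        + u ^ 4 * (3844 / 8037225))"
    by (simp add: u_def field_simps power_numeral_reduce)
  also have "\<dots> \<ge> 0" using u by (intro mult_nonneg_nonneg add_nonneg_nonneg) auto
  finally show "1 - (t - t ^ 3 / 3 + 2 * t ^ 5 / 15 - 17 * t ^ 7 / 315 + 62 * t ^ 9 / 2835)\<^sup>2
      \<le> 1 - t ^ 2 + 2 * t ^ 4 / 3 - 17 * t ^ 6 / 45 + 62 * t ^ 8 / 315" by simp
qed auto

subsection \<open>The extremal function\<close>

text \<open>Away from 0 the integrand is \<open>(sigmoid t - 1) / t\<close>, so this is the branch
  of the logarithm of \<open>f0 z / z\<close> on the unit disc that vanishes at 0.\<close>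

definition log_f0 :: "complex \<Rightarrow> complex" where
  "log_f0 z = contour_integral (linepath 0 z) (\<lambda>t. (exp t - 1) / (t * (exp t + 1)))"

lemma f0_eq: "f0 z = z * exp (log_f0 z)"
  by (simp add: f0_def log_f0_def)

lemma one_plus_exp_nonzero:
  fixes z :: complex
  assumes "norm z < 1"
  shows "1 + exp z \<noteq> 0"
proof -
  have "\<bar>Im z\<bar> < pi / 2" using abs_Im_le_cmod[of z] assms pi_gt3 by linarith
  hence "0 < Re (1 + exp z)" by (simp add: Re_exp cos_gt_zero_pi add_pos_pos)
  thus ?thesis by force
qed

lemma scale_in_unit_disc:
  assumes "z \<in> unit_disc" "0 \<le> s" "s \<le> 1"
  shows "of_real s * z \<in> unit_disc"
proof -
  have "s * norm z \<le> norm z" using assms by (intro mult_left_le_one_le) auto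
  also have "\<dots> < 1" using assms by simp
  finally show ?thesis using assms by (simp add: norm_mult)
qed

lemma sigmoid_holomorphic: "sigmoid holomorphic_on unit_disc"
  unfolding sigmoid_def[abs_def]
  by (intro holomorphic_intros) (use one_plus_exp_nonzero[of "- _"] in \<open>auto\<close>)

lemma sigmoid_0 [simp]: "sigmoid 0 = 1"
  by (simp add: sigmoid_def)

text \<open>The integrand extends holomorphically over 0 and therefore has a primitive on the convex
  disc; \<open>log_f0\<close> is that primitive normalised at 0. The product form
  \<open>z * k z\<close> stays valid at 0.\<close>

lemma log_f0_has_field_derivative:
  obtains k where "k holomorphic_on unit_disc"
    "\<And>z. z \<in> unit_disc \<Longrightarrow> z * k z = sigmoid z - 1"
    "\<And>z. z \<in> unit_disc \<Longrightarrow> (log_f0 has_field_derivative k z) (at z)"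
proof -
  define k where "k = (\<lambda>z. if z = 0 then deriv sigmoid 0 else (sigmoid z - sigmoid 0) / (z - 0))"
  have hol: "k holomorphic_on unit_disc"
    unfolding k_def by (rule pole_lemma[OF sigmoid_holomorphic]) auto
  have eq: "z * k z = sigmoid z - 1" for z by (simp add: k_def)
  obtain G where G: "\<And>z. z \<in> unit_disc \<Longrightarrow> (G has_field_derivative k z) (at z within unit_disc)"
    using holomorphic_convex_primitive'[OF convex_ball open_ball hol] by blast
  have log: "log_f0 z = G z - G 0" if z: "z \<in> unit_disc" for z
  proof (cases "z = 0")
    case False
    have "path_image (linepath 0 z) \<subseteq> unit_disc"
      using z by (simp add: closed_segment_subset)
    hence "(k has_contour_integral (G z - G 0)) (linepath 0 z)"
      using contour_integral_primitive[OF G, of "linepath 0 z"] by simp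
    hence k_int: "((\<lambda>x. k (linepath 0 z x) * (z - 0)) has_integral (G z - G 0)) {0..1}"
      by (simp only: has_contour_integral_linepath)
    have k_eq: "(exp t - 1) / (t * (exp t + 1)) = k t" if "t \<noteq> 0" "t \<in> unit_disc" for t
    proof -
      have "exp t + 1 \<noteq> 0" using that one_plus_exp_nonzero[of t] by (simp add: add.commute)
      moreover have "exp (-t) * exp t = 1" by (simp add: exp_minus)
      ultimately have "sigmoid t = 2 * exp t / (exp t + 1)"
        by (simp add: sigmoid_def exp_minus divide_simps)
      hence "sigmoid t - 1 = (exp t - 1) / (exp t + 1)"
        using \<open>exp t + 1 \<noteq> 0\<close> by (simp add: field_simps)
      thus ?thesis using that by (simp add: k_def)
    qed
    have line: "linepath 0 z x \<noteq> 0" "linepath 0 z x \<in> unit_disc" if "x \<in> {0..1} - {0}" for x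
    proof -
      show "linepath 0 z x \<noteq> 0" using that False by (simp add: linepath_def)
      show "linepath 0 z x \<in> unit_disc"
        using that scale_in_unit_disc[OF z, of x] by (simp add: linepath_def scaleR_conv_of_real)
    qed
    \<comment> \<open>At \<open>x = 0\<close> the original integrand is 0/0, hence 0 by convention,
      and need not agree with \<open>k\<close>; a single point does not change the integral.\<close>
    have "((\<lambda>x. (exp (linepath 0 z x) - 1) / (linepath 0 z x * (exp (linepath 0 z x) + 1)) * (z - 0))
        has_integral (G z - G 0)) {0..1}"
    proof (rule has_integral_spike_finite[OF _ _ k_int, of "{0}"])
      fix x :: real assume x: "x \<in> {0..1} - {0}"
      show "(exp (linepath 0 z x) - 1) / (linepath 0 z x * (exp (linepath 0 z x) + 1)) * (z - 0) =
          k (linepath 0 z x) * (z - 0)"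
        by (simp only: k_eq[OF line[OF x]])
    qed simp
    thus ?thesis unfolding log_f0_def
      by (intro contour_integral_unique) (simp only: has_contour_integral_linepath)
  qed (simp add: log_f0_def)
  have "(log_f0 has_field_derivative k z) (at z)" if z: "z \<in> unit_disc" for z
  proof -
    have "(G has_field_derivative k z) (at z)"
      using G[OF z] unfolding at_within_open[OF z open_ball] .
    hence "((\<lambda>z. G z - G 0) has_field_derivative k z - 0) (at z)"
      by (intro DERIV_diff DERIV_const)
    hence "(log_f0 has_field_derivative k z - 0) (at z)"
      by (rule has_field_derivative_transform_within_open[OF _ open_ball z]) (simp add: log)
    thus ?thesis by simp
  qed
  thus ?thesis by (rule that[OF hol eq])
qed

lemma log_f0_0 [simp]: "log_f0 0 = 0"
  by (simp add: log_f0_def)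

lemma log_f0_holomorphic: "log_f0 holomorphic_on unit_disc"
  by (metis log_f0_has_field_derivative field_differentiable_def field_differentiable_at_within
      holomorphic_on_def)

lemma log_f0_deriv: "z \<in> unit_disc \<Longrightarrow> z * deriv log_f0 z = sigmoid z - 1"
  by (metis log_f0_has_field_derivative DERIV_imp_deriv)

lemma sigmoid_of_real: "sigmoid (of_real t) - 1 = of_real (tanh (t / 2))"
proof -
  have "tanh (t / 2) = (1 - exp (-t)) / (1 + exp (-t))" by (simp add: tanh_real_altdef)
  also have "\<dots> = 2 / (1 + exp (-t)) - 1"
    using exp_gt_zero[of "-t"] by (simp add: field_simps add_pos_pos less_imp_neq[symmetric])
  finally show ?thesis by (simp add: sigmoid_def exp_of_real[symmetric])
qed

section \<open>Radial derivatives and the extremal function on the real axis\<close>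

lemma has_vector_derivative_along_ray:
  assumes H: "H holomorphic_on unit_disc" and t: "of_real t * z \<in> unit_disc"
  shows "((\<lambda>s. H (of_real s * z)) has_vector_derivative z * deriv H (of_real t * z)) (at t)"
proof -
  have "((\<lambda>w. H (w * z)) has_field_derivative deriv H (of_real t * z) * z) (at (of_real t))"
    by (rule DERIV_chain2[where f = H and g = "\<lambda>w. w * z", OF holomorphic_derivI[OF H open_ball t]])
      (auto intro!: derivative_eq_intros)
  from has_vector_derivative_real_field[OF this] show ?thesis by (simp add: mult.commute)
qed

lemma continuous_on_along_ray:
  assumes H: "H holomorphic_on unit_disc" and z: "z \<in> unit_disc"
  shows "continuous_on {0..1} (\<lambda>s. H (of_real s * z))"
proof (rule continuous_on_compose2[OF holomorphic_on_imp_continuous_on[OF H]])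
  show "(\<lambda>s. of_real s * z) ` {0..1} \<subseteq> unit_disc"
    using scale_in_unit_disc[OF z] by auto
qed (intro continuous_intros)

lemma Re_log_f0_deriv:
  assumes "0 < t" "t < 1"
  shows "((\<lambda>s. Re (log_f0 (of_real s))) has_real_derivative tanh (t / 2) / t) (at t)"
    and "((\<lambda>s. Im (log_f0 (of_real s))) has_real_derivative 0) (at t)"
proof -
  have t: "of_real t \<in> unit_disc" using assms by simp
  have "deriv log_f0 (of_real t) = of_real (tanh (t / 2) / t)"
    using log_f0_deriv[OF t] assms by (simp add: sigmoid_of_real field_simps)
  thus "((\<lambda>s. Re (log_f0 (of_real s))) has_real_derivative tanh (t / 2) / t) (at t)"
    "((\<lambda>s. Im (log_f0 (of_real s))) has_real_derivative 0) (at t)"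
    using has_vector_derivative_along_ray[OF log_f0_holomorphic, of t 1] t
    by (simp_all add: has_vector_derivative_complex_iff)
qed

lemma continuous_on_log_f0_real: "continuous_on {-1<..<1} (\<lambda>t. log_f0 (of_real t))"
  by (rule continuous_on_compose2[OF holomorphic_on_imp_continuous_on[OF log_f0_holomorphic]])
    (auto intro!: continuous_intros)

lemma log_f0_real:
  assumes "0 \<le> t" "t < 1"
  shows "log_f0 (of_real t) = of_real (Re (log_f0 (of_real t)))"
proof (cases "t = 0")
  case False
  have "Im (log_f0 (of_real t)) = Im (log_f0 (of_real 0))"
  proof (rule DERIV_isconst_end[of 0 t "\<lambda>s. Im (log_f0 (of_real s))"])
    show "0 < t" using False assms by simp
    show "continuous_on {0..t} (\<lambda>s. Im (log_f0 (of_real s)))"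
      using assms by (intro continuous_intros continuous_on_subset[OF continuous_on_log_f0_real]) auto
  qed (use assms Re_log_f0_deriv in auto)
  thus ?thesis by (simp add: complex_eq_iff)
qed simp

text \<open>A real-valued version of \<open>f0\<close>, so that monotonicity and the intermediate
  value theorem apply. Taking \<open>Re\<close> loses nothing on \<open>[0, 1)\<close>, where
  \<open>log_f0\<close> is real.\<close>

definition f0_real :: "real \<Rightarrow> real" where
  "f0_real r = r * exp (Re (log_f0 (of_real r)))"

lemma f0_of_real: "0 \<le> r \<Longrightarrow> r < 1 \<Longrightarrow> f0 (of_real r) = of_real (f0_real r)"
  unfolding f0_eq f0_real_def by (subst log_f0_real) (simp_all add: exp_of_real)

text \<open>An upper bound for the integral of \<open>tanh (u / 2) / u\<close>, phrased through an
  antiderivative \<open>p\<close>. Derivatives are compared only in the open interval, because the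
  quotient degenerates at \<open>u = 0\<close>; continuity covers the endpoints.\<close>

lemma Re_log_f0_diff_le:
  fixes p p' :: "real \<Rightarrow> real"
  assumes "0 \<le> s" "s \<le> t" "t < 1"
    and "\<And>u. (p has_real_derivative p' u) (at u)"
    and "\<And>u. s < u \<Longrightarrow> u < t \<Longrightarrow> tanh (u / 2) / u \<le> p' u"
  shows "Re (log_f0 (of_real t)) - Re (log_f0 (of_real s)) \<le> p t - p s"
proof -
  let ?D = "\<lambda>u. Re (log_f0 (of_real u)) - p u"
  have "?D t \<le> ?D s"
  proof (rule DERIV_nonpos_imp_decreasing_open[of s t ?D])
    fix u assume u: "s < u" "u < t"
    have "(?D has_real_derivative tanh (u / 2) / u - p' u) (at u)"
      using u assms by (intro DERIV_diff Re_log_f0_deriv) auto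
    thus "\<exists>y. (?D has_real_derivative y) (at u) \<and> y \<le> 0" using assms(5)[OF u] by force
  next
    have "continuous_on {s..t} p"
      by (meson assms(4) DERIV_isCont continuous_at_imp_continuous_on)
    thus "continuous_on {s..t} ?D"
      using assms by (intro continuous_intros continuous_on_subset[OF continuous_on_log_f0_real]) auto
  qed fact
  thus ?thesis by simp
qed

lemma Re_log_f0_diff_ge:
  fixes p p' :: "real \<Rightarrow> real"
  assumes "0 \<le> s" "s \<le> t" "t < 1"
    and "\<And>u. (p has_real_derivative p' u) (at u)"
    and "\<And>u. s < u \<Longrightarrow> u < t \<Longrightarrow> p' u \<le> tanh (u / 2) / u"
  shows "p t - p s \<le> Re (log_f0 (of_real t)) - Re (log_f0 (of_real s))"
proof -
  let ?D = "\<lambda>u. Re (log_f0 (of_real u)) - p u"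
  have "?D s \<le> ?D t"
  proof (rule DERIV_nonneg_imp_increasing_open[of s t ?D])
    fix u assume u: "s < u" "u < t"
    have "(?D has_real_derivative tanh (u / 2) / u - p' u) (at u)"
      using u assms by (intro DERIV_diff Re_log_f0_deriv) auto
    thus "\<exists>y. (?D has_real_derivative y) (at u) \<and> 0 \<le> y" using assms(5)[OF u] by force
  next
    have "continuous_on {s..t} p"
      by (meson assms(4) DERIV_isCont continuous_at_imp_continuous_on)
    thus "continuous_on {s..t} ?D"
      using assms by (intro continuous_intros continuous_on_subset[OF continuous_on_log_f0_real]) auto
  qed fact
  thus ?thesis by simp
qed

lemma f0_real_strict_mono:
  assumes "0 \<le> s" "s < t" "t < 1"
  shows "f0_real s < f0_real t"
proof -
  \<comment> \<open>Comparison with the zero function is monotonicity, as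
    \<open>tanh (u / 2) / u\<close> is nonnegative.\<close>
  have "Re (log_f0 (of_real s)) \<le> Re (log_f0 (of_real t))"
    using Re_log_f0_diff_ge[of s t "\<lambda>_. 0" "\<lambda>_. 0"] assms by auto
  hence "s * exp (Re (log_f0 (of_real s))) \<le> s * exp (Re (log_f0 (of_real t)))"
    using assms by (intro mult_left_mono) auto
  also have "\<dots> < t * exp (Re (log_f0 (of_real t)))" using assms by simp
  finally show ?thesis by (simp add: f0_real_def)
qed

text \<open>The polynomial is the degree 9 Taylor polynomial of \<open>tanh\<close> at
  \<open>u / 2\<close>, divided by \<open>u\<close> and integrated termwise from 0. Since
  \<open>u < 1\<close>, the argument \<open>u / 2\<close> lies in the range of
  \<open>tanh_le_Taylor9\<close>.\<close>

lemma Re_log_f0_le_Taylor9: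
  assumes "0 \<le> r" "r < 1"
  shows "Re (log_f0 (of_real r)) \<le>
    r / 2 - r ^ 3 / 72 + r ^ 5 / 1200 - 17 * r ^ 7 / 282240 + 31 * r ^ 9 / 6531840"
proof -
  let ?p = "\<lambda>r::real. r / 2 - r ^ 3 / 72 + r ^ 5 / 1200 - 17 * r ^ 7 / 282240 + 31 * r ^ 9 / 6531840"
  let ?p' = "\<lambda>r::real. 1 / 2 - r ^ 2 / 24 + r ^ 4 / 240 - 17 * r ^ 6 / 40320 + 31 * r ^ 8 / 725760"
  have "Re (log_f0 (of_real r)) - Re (log_f0 (of_real 0)) \<le> ?p r - ?p 0"
  proof (rule Re_log_f0_diff_le[of 0 r ?p ?p'])
    show "(?p has_real_derivative ?p' u) (at u)" for u
      by (auto intro!: derivative_eq_intros)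
    fix u assume u: "0 < u" "u < r"
    hence "tanh (u / 2) \<le> u * ?p' u"
      using tanh_le_Taylor9[of "u / 2"] assms
      by (simp add: power_divide algebra_simps power_numeral_reduce)
    thus "tanh (u / 2) / u \<le> ?p' u" using u by (simp add: divide_le_eq mult.commute)
  qed (use assms in auto)
  thus ?thesis by simp
qed

lemma Re_log_f0_ge_Taylor7:
  assumes "0 \<le> r" "r < 1"
  shows "r / 2 - r ^ 3 / 72 + r ^ 5 / 1200 - 17 * r ^ 7 / 282240 \<le> Re (log_f0 (of_real r))"
proof -
  let ?p = "\<lambda>r::real. r / 2 - r ^ 3 / 72 + r ^ 5 / 1200 - 17 * r ^ 7 / 282240"
  let ?p' = "\<lambda>r::real. 1 / 2 - r ^ 2 / 24 + r ^ 4 / 240 - 17 * r ^ 6 / 40320"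
  have "?p r - ?p 0 \<le> Re (log_f0 (of_real r)) - Re (log_f0 (of_real 0))"
  proof (rule Re_log_f0_diff_ge[of 0 r ?p ?p'])
    show "(?p has_real_derivative ?p' u) (at u)" for u
      by (auto intro!: derivative_eq_intros)
    fix u assume u: "0 < u" "u < r"
    hence "u * ?p' u \<le> tanh (u / 2)"
      using tanh_ge_Taylor7[of "u / 2"] assms
      by (simp add: power_divide algebra_simps power_numeral_reduce)
    thus "?p' u \<le> tanh (u / 2) / u" using u by (simp add: le_divide_eq mult.commute)
  qed (use assms in auto)
  thus ?thesis by simp
qed

subsection \<open>Growth of functions in the class\<close>

text \<open>Only the size of \<open>\<omega>\<close> matters from here on, so its holomorphy is
  spent on the Schwarz lemma. A zero of \<open>f\<close> off the origin would make the quotient 0 by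
  the convention for division by 0, while \<open>sigmoid\<close> has no zero on the disc.\<close>

lemma class_S_SG_Schwarz:
  assumes "f \<in> class_S_SG"
  shows "\<exists>\<omega>. \<forall>z\<in>unit_disc. norm (\<omega> z) \<le> norm z \<and>
    starlike_quotient f z = sigmoid (\<omega> z) \<and> (z \<noteq> 0 \<longrightarrow> f z \<noteq> 0)"
proof -
  obtain \<omega> where \<omega>: "\<omega> holomorphic_on unit_disc" "\<omega> ` unit_disc \<subseteq> unit_disc" "\<omega> 0 = 0"
      "\<And>w. w \<in> unit_disc \<Longrightarrow> starlike_quotient f w = sigmoid (\<omega> w)"
    using assms by (auto simp: class_S_SG_def subordinate_def)
  have le: "norm (\<omega> z) \<le> norm z" if "z \<in> unit_disc" for z
    using Schwarz_Lemma(1)[OF \<omega>(1,3), of z] \<omega>(2) that by (auto simp: image_subset_iff)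
  have "f z \<noteq> 0" if z: "z \<in> unit_disc" "z \<noteq> 0" for z
  proof
    assume "f z = 0"
    hence "sigmoid (\<omega> z) = 0" using \<omega>(4)[OF z(1)] z by (simp add: starlike_quotient_def)
    moreover have "norm (- \<omega> z) < 1" using z le[of z] by simp
    ultimately show False using one_plus_exp_nonzero[of "- \<omega> z"] by (simp add: sigmoid_def)
  qed
  thus ?thesis using le \<omega>(4) by blast
qed

text \<open>Writing \<open>f w = w * exp (H w)\<close> turns the subordination into
  \<open>w * deriv H w = sigmoid (\<omega> w) - 1\<close>. Along the ray to \<open>z\<close>, the
  real part of \<open>H\<close> then grows no faster than that of \<open>log_f0\<close> along the
  ray to \<open>norm z\<close>, and both start at 0.\<close>

lemma norm_le_f0_real:
  assumes f: "f \<in> class_S_SG" and z: "norm z < 1"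
  shows "norm (f z) \<le> f0_real (norm z)"
proof -
  obtain \<omega> where "\<forall>w\<in>unit_disc. norm (\<omega> w) \<le> norm w \<and>
      starlike_quotient f w = sigmoid (\<omega> w) \<and> (w \<noteq> 0 \<longrightarrow> f w \<noteq> 0)"
    using class_S_SG_Schwarz[OF f] by blast
  hence \<omega>_le: "\<And>w. w \<in> unit_disc \<Longrightarrow> norm (\<omega> w) \<le> norm w"
    and \<omega>: "\<And>w. w \<in> unit_disc \<Longrightarrow> starlike_quotient f w = sigmoid (\<omega> w)"
    and f_nz: "\<And>w. w \<in> unit_disc \<Longrightarrow> w \<noteq> 0 \<Longrightarrow> f w \<noteq> 0"
    by blast+
  have hol: "f holomorphic_on unit_disc" and f_0: "f 0 = 0" "deriv f 0 = 1"
    using f by (auto simp: class_S_SG_def class_A_def)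
  define g where "g = (\<lambda>w. if w = 0 then deriv f 0 else (f w - f 0) / (w - 0))"
  have g_hol: "g holomorphic_on unit_disc" unfolding g_def by (rule pole_lemma[OF hol]) auto
  have g_nz: "g w \<noteq> 0" if "w \<in> unit_disc" for w using f_nz[OF that] f_0 by (simp add: g_def)
  have "\<exists>H. H holomorphic_on unit_disc \<and> (\<forall>w\<in>unit_disc. exp (H w) = g w)"
  proof (rule holomorphic_logarithm_exists[OF convex_ball open_ball g_hol g_nz])
    show "0 \<in> unit_disc" by simp
  qed blast+
  then obtain H where H: "H holomorphic_on unit_disc" "\<And>w. w \<in> unit_disc \<Longrightarrow> exp (H w) = g w"
    by blast
  have f_eq: "f w = w * exp (H w)" if "w \<in> unit_disc" for w
    using H(2)[OF that] f_0 by (simp add: g_def)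
  \<comment> \<open>The logarithm is determined only up to multiples of
    \<open>2 * pi * \<i>\<close>, so just the real part of \<open>H 0\<close> is known to
    vanish.\<close>
  have "exp (Re (H 0)) = 1" using H(2)[of 0] f_0 norm_exp_eq_Re[of "H 0"] by (simp add: g_def)
  hence H0: "Re (H 0) = 0" by simp
  have dH: "w * deriv H w = sigmoid (\<omega> w) - 1" if w: "w \<in> unit_disc" for w
  proof (cases "w = 0")
    case False
    have "((\<lambda>w. w * exp (H w)) has_field_derivative 1 * exp (H w) + (exp (H w) * deriv H w) * w) (at w)"
      by (intro DERIV_mult DERIV_ident DERIV_chain2[OF DERIV_exp] holomorphic_derivI[OF H(1) open_ball w])
    hence "((\<lambda>w. w * exp (H w)) has_field_derivative exp (H w) + w * (exp (H w) * deriv H w)) (at w)"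
      by (simp add: mult.commute)
    hence "(f has_field_derivative exp (H w) + w * (exp (H w) * deriv H w)) (at w)"
      by (rule has_field_derivative_transform_within_open[OF _ open_ball w]) (simp add: f_eq)
    hence "deriv f w = exp (H w) + w * (exp (H w) * deriv H w)" by (rule DERIV_imp_deriv)
    hence "starlike_quotient f w = 1 + w * deriv H w"
      using False f_eq[OF w] by (simp add: starlike_quotient_def field_simps)
    thus ?thesis using \<omega>[OF w] by simp
  next
    case True
    thus ?thesis using \<omega>_le[of 0] by simp
  qed
  define r where "r = norm z"
  have zD: "z \<in> unit_disc" and rD: "complex_of_real r \<in> unit_disc" using z by (simp_all add: r_def)
  let ?D = "\<lambda>s. Re (H (of_real s * z)) - Re (log_f0 (of_real s * of_real r))"
  have "?D 1 \<le> ?D 0"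
  proof (rule DERIV_nonpos_imp_decreasing_open[of 0 1 ?D])
    show "continuous_on {0..1} ?D"
      by (intro continuous_intros continuous_on_along_ray H(1) log_f0_holomorphic zD rD)
    fix s :: real assume s: "0 < s" "s < 1"
    define w where "w = of_real s * z"
    have sz: "w \<in> unit_disc" and sr: "of_real s * complex_of_real r \<in> unit_disc"
      using scale_in_unit_disc[OF zD, of s] scale_in_unit_disc[OF rD, of s] s by (simp_all add: w_def)
    let ?d = "Re (z * deriv H w) - Re (of_real r * deriv log_f0 (of_real s * of_real r))"
    have "(?D has_real_derivative ?d) (at s)"
      using has_vector_derivative_along_ray[OF H(1), of s z] sz
        has_vector_derivative_along_ray[OF log_f0_holomorphic sr]
      unfolding w_def by (intro DERIV_diff has_field_derivative_Re) auto
    moreover have "?d \<le> 0"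
    proof -
      \<comment> \<open>Multiplying by \<open>s > 0\<close> produces the products
        \<open>w * deriv H w\<close> and its analogue for \<open>log_f0\<close>, to which
        \<open>dH\<close> and \<open>log_f0_deriv\<close> apply. The Schwarz bound gives
        \<open>norm (\<omega> w) \<le> s * r\<close>.\<close>
      have "s * ?d = Re (w * deriv H w) - Re ((of_real s * of_real r) * deriv log_f0 (of_real s * of_real r))"
        by (simp add: w_def algebra_simps)
      also have "\<dots> = Re (sigmoid (\<omega> w) - 1) - tanh (s * r / 2)"
        unfolding dH[OF sz] log_f0_deriv[OF sr] by (simp flip: of_real_mult add: sigmoid_of_real)
      also have "\<dots> \<le> 0"
        using Re_sigmoid_minus_one_le[of "\<omega> w" "s * r"] \<omega>_le[of w] sz s sr
        by (simp add: w_def norm_mult r_def)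
      finally show ?thesis using s by (simp add: mult_le_0_iff)
    qed
    ultimately show "\<exists>y. (?D has_real_derivative y) (at s) \<and> y \<le> 0" by blast
  qed simp
  hence "Re (H z) \<le> Re (log_f0 (of_real r))" using H0 by simp
  hence "r * exp (Re (H z)) \<le> r * exp (Re (log_f0 (of_real r)))"
    by (intro mult_left_mono) (simp_all add: r_def)
  thus ?thesis using f_eq[OF zD] by (simp add: norm_mult f0_real_def r_def)
qed

lemma norm_deriv_minus_le:
  assumes f: "f \<in> class_S_SG" and z: "norm z < 1"
  shows "norm (z * deriv f z - f z) \<le> f0_real (norm z) * tan (norm z / 2)"
proof (cases "z = 0")
  case True
  thus ?thesis using f by (simp add: class_S_SG_def class_A_def f0_real_def)
next
  case False
  have "z \<in> unit_disc" using z by simp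
  then obtain \<omega> where \<omega>_le: "norm (\<omega> z) \<le> norm z"
    and \<omega>: "starlike_quotient f z = sigmoid (\<omega> z)" and f_nz: "f z \<noteq> 0"
    using class_S_SG_Schwarz[OF f] False by blast
  have "norm (sigmoid (\<omega> z) - 1) \<le> tan (norm z / 2)"
    using \<omega>_le z by (rule norm_sigmoid_minus_one_le)
  moreover have "z * deriv f z - f z = f z * (sigmoid (\<omega> z) - 1)"
    using \<omega> f_nz False by (simp add: starlike_quotient_def field_simps)
  moreover have "0 \<le> f0_real (norm z)" by (simp add: f0_real_def)
  ultimately show ?thesis
    using norm_le_f0_real[OF f z] by (simp add: norm_mult mult_mono)
qed

subsection \<open>Location of the root\<close>

lemma exp_Taylor_bounds:
  fixes x :: real
  assumes "0 \<le> x" "x \<le> 1"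
  shows "(\<Sum>m<n. x ^ m / fact m) \<le> exp x"
    and "exp x \<le> (\<Sum>m<n. x ^ m / fact m) + 3 * x ^ n / fact n"
proof -
  obtain t where t: "\<bar>t\<bar> \<le> \<bar>x\<bar>" "exp x = (\<Sum>m<n. x ^ m / fact m) + exp t / fact n * x ^ n"
    using Maclaurin_exp_le[of x n] by blast
  have "exp t \<le> exp 1" using t(1) assms by simp
  hence "exp t \<le> 3" using exp_le by linarith
  hence "exp t / fact n * x ^ n \<le> 3 / fact n * x ^ n"
    using assms by (intro mult_right_mono divide_right_mono) auto
  thus "exp x \<le> (\<Sum>m<n. x ^ m / fact m) + 3 * x ^ n / fact n" using t(2) by simp
  have "0 \<le> exp t / fact n * x ^ n" using assms by simp
  thus "(\<Sum>m<n. x ^ m / fact m) \<le> exp x" using t(2) by simp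
qed

lemma Maclaurin_cos_bound:
  fixes x :: real
  shows "\<bar>cos x - (\<Sum>m<n. cos_coeff m * x ^ m)\<bar> \<le> \<bar>x\<bar> ^ n / fact n"
proof -
  obtain t where "cos x = (\<Sum>m<n. cos_coeff m * x ^ m) + (cos (t + 1/2 * real n * pi) / fact n) * x ^ n"
    using Maclaurin_cos_expansion[of x n] by blast
  hence "\<bar>cos x - (\<Sum>m<n. cos_coeff m * x ^ m)\<bar> = \<bar>cos (t + 1/2 * real n * pi)\<bar> * \<bar>x\<bar> ^ n / fact n"
    by (simp add: abs_mult power_abs)
  also have "\<dots> \<le> 1 * \<bar>x\<bar> ^ n / fact n"
    by (intro divide_right_mono mult_right_mono abs_cos_le_one) auto
  finally show ?thesis by simp
qed

text \<open>The constant 39916800 is \<open>fact 11\<close>, from the remainder after all terms of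
  degree below 11.\<close>

lemma sin_Taylor_bounds:
  fixes x :: real
  defines "p \<equiv> x - x ^ 3 / 6 + x ^ 5 / 120 - x ^ 7 / 5040 + x ^ 9 / 362880"
  assumes "0 \<le> x"
  shows "p - x ^ 11 / 39916800 \<le> sin x" and "sin x \<le> p + x ^ 11 / 39916800"
proof -
  have "(\<Sum>m<11. sin_coeff m * x ^ m) = p"
    by (simp add: p_def lessThan_nat_numeral lessThan_Suc sin_coeff_def fact_numeral)
  moreover have "\<bar>sin x - (\<Sum>m<11. sin_coeff m * x ^ m)\<bar> \<le> x ^ 11 / 39916800"
    using Maclaurin_sin_bound[of x 11] assms(2) by (simp add: fact_numeral field_simps)
  ultimately have "\<bar>sin x - p\<bar> \<le> x ^ 11 / 39916800" by (simp only:)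
  thus "p - x ^ 11 / 39916800 \<le> sin x" and "sin x \<le> p + x ^ 11 / 39916800"
    unfolding abs_le_iff by linarith+
qed

lemma cos_Taylor_bounds:
  fixes x :: real
  defines "p \<equiv> 1 - x ^ 2 / 2 + x ^ 4 / 24 - x ^ 6 / 720 + x ^ 8 / 40320 - x ^ 10 / 3628800"
  assumes "0 \<le> x"
  shows "p - x ^ 12 / 479001600 \<le> cos x" and "cos x \<le> p + x ^ 12 / 479001600"
proof -
  have "(\<Sum>m<12. cos_coeff m * x ^ m) = p"
    by (simp add: p_def lessThan_nat_numeral lessThan_Suc cos_coeff_def fact_numeral)
  moreover have "\<bar>cos x - (\<Sum>m<12. cos_coeff m * x ^ m)\<bar> \<le> x ^ 12 / 479001600"
    using Maclaurin_cos_bound[of x 12] assms(2) by (simp add: fact_numeral)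
  ultimately have "\<bar>cos x - p\<bar> \<le> x ^ 12 / 479001600" by (simp only:)
  thus "p - x ^ 12 / 479001600 \<le> cos x" and "cos x \<le> p + x ^ 12 / 479001600"
    unfolding abs_le_iff by linarith+
qed

text \<open>Decimals \<open>q\<close> for the exponent and \<open>e\<close> for its exponential
  reduce the estimate to rational arithmetic.\<close>

lemma f0_real_le:
  assumes "0 \<le> r" "r < 1"
    and "r / 2 - r ^ 3 / 72 + r ^ 5 / 1200 - 17 * r ^ 7 / 282240 + 31 * r ^ 9 / 6531840 \<le> q"
    and "exp q \<le> e"
  shows "f0_real r \<le> r * e"
proof -
  have "exp (Re (log_f0 (of_real r))) \<le> exp q"
    using Re_log_f0_le_Taylor9[of r] assms by simp
  also note assms(4)
  finally show ?thesis unfolding f0_real_def using assms(1) by (rule mult_left_mono)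
qed

lemma f0_real_ge:
  assumes "0 \<le> r" "r < 1"
    and "q \<le> r / 2 - r ^ 3 / 72 + r ^ 5 / 1200 - 17 * r ^ 7 / 282240"
    and "e \<le> exp q"
  shows "r * e \<le> f0_real r"
proof -
  note assms(4)
  also have "exp q \<le> exp (Re (log_f0 (of_real r)))"
    using Re_log_f0_ge_Taylor7[of r] assms by simp
  finally show ?thesis unfolding f0_real_def using assms(1) by (rule mult_left_mono)
qed

text \<open>The point is \<open>0.799269 - 5 / 10^7\<close>, the left end of the interval claimed
  for the root. The decimals bound the exponential and the sine from above and the cosine from
  below, so every factor is overestimated.\<close>

lemma two_tan_half_f0_real_less_1: "2 * tan (0.7992685 / 2) * f0_real 0.7992685 < 1"
proof -
  have "exp 0.392802529 \<le> (1.4811258811 :: real)"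
    using exp_Taylor_bounds(2)[of "0.392802529" 12]
    by (simp add: lessThan_nat_numeral lessThan_Suc fact_numeral power_divide)
  hence E: "f0_real 0.7992685 \<le> 0.7992685 * 1.4811258811"
    by (intro f0_real_le) (simp_all add: power_divide)
  have s: "sin (0.7992685 / 2) \<le> (0.3890814383 :: real)"
    by (rule order_trans[OF sin_Taylor_bounds(2)]) (simp_all add: power_divide)
  have c: "(0.9212033621 :: real) \<le> cos (0.7992685 / 2)"
    by (rule order_trans[OF _ cos_Taylor_bounds(1)]) (simp_all add: power_divide)
  have t: "tan (0.7992685 / 2) \<le> (0.3890814383 / 0.9212033621 :: real)"
    unfolding tan_def by (rule frac_le[OF _ s _ c]) simp_all
  have "2 * tan (0.7992685 / 2) * f0_real 0.7992685 \<le>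
      2 * (0.3890814383 / 0.9212033621) * (0.7992685 * 1.4811258811)"
    by (rule mult_mono[OF mult_left_mono[OF t] E]) (simp_all add: f0_real_def)
  also have "\<dots> < 1" by simp
  finally show ?thesis .
qed

text \<open>The right end \<open>0.799269 + 5 / 10^7\<close>, with all roundings reversed.\<close>

lemma two_tan_half_f0_real_greater_1: "1 < 2 * tan (0.7992695 / 2) * f0_real 0.7992695"
proof -
  have "(1.4811256486 :: real) \<le> exp 0.3928023721"
    using exp_Taylor_bounds(1)[of "0.3928023721" 12]
    by (simp add: lessThan_nat_numeral lessThan_Suc fact_numeral power_divide)
  hence E: "0.7992695 * 1.4811256486 \<le> f0_real 0.7992695"
    by (intro f0_real_ge) (simp_all add: power_divide)
  have s: "(0.3890818988 :: real) \<le> sin (0.7992695 / 2)"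
    by (rule order_trans[OF _ sin_Taylor_bounds(1)]) (simp_all add: power_divide)
  have c: "cos (0.7992695 / 2) \<le> (0.9212031677 :: real)"
    by (rule order_trans[OF cos_Taylor_bounds(2)]) (simp_all add: power_divide)
  have c0: "0 < cos (0.7992695 / 2 :: real)"
    using pi_gt3 by (intro cos_gt_zero_pi) auto
  have t: "(0.3890818988 / 0.9212031677 :: real) \<le> tan (0.7992695 / 2)"
    unfolding tan_def by (rule frac_le[OF _ s c0 c]) (rule order_trans[OF _ s], simp)
  have "1 < 2 * (0.3890818988 / 0.9212031677) * (0.7992695 * (1.4811256486 :: real))" by simp
  also have "\<dots> \<le> 2 * tan (0.7992695 / 2) * f0_real 0.7992695"
    by (rule mult_mono[OF mult_left_mono[OF t] E]) (use order_trans[OF _ t] in simp_all)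
  finally show ?thesis .
qed

subsection \<open>Taylor coefficients of the extremal function\<close>

lemma f0_has_fps_expansion:
  "\<exists>F. f0 has_fps_expansion F \<and>
     fps_nth F 0 = 0 \<and> fps_nth F 1 = 1 \<and> fps_nth F 2 = 1 / 2 \<and>
     fps_nth F 3 = 1 / 8 \<and> fps_nth F 4 = 1 / 144 \<and> fps_nth F 5 = - 5 / 1152"
proof -
  define K where "K = fps_expansion (\<lambda>z. exp (log_f0 z)) 0"
  have "(\<lambda>z. exp (log_f0 z)) holomorphic_on unit_disc"
    by (intro holomorphic_intros log_f0_holomorphic)
  hence "(\<lambda>z. exp (log_f0 z)) analytic_on unit_disc" by (simp add: analytic_on_open)
  hence "(\<lambda>z. exp (log_f0 z)) analytic_on {0}" by (rule analytic_on_subset) simp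
  hence K: "(\<lambda>z. exp (log_f0 z)) has_fps_expansion K"
    unfolding K_def by (rule analytic_at_imp_has_fps_expansion_0)
  define F where "F = fps_X * K"
  have F: "f0 has_fps_expansion F"
    unfolding F_def f0_eq[abs_def] by (intro fps_expansion_intros K)
  have K0: "fps_nth K 0 = 1" using has_fps_expansion_imp_0_eq_fps_nth_0[OF K] by simp
  \<comment> \<open>The recurrence below multiplies the coefficient of index \<open>n\<close> by
    \<open>2 * (n - 1)\<close> and so cannot determine index 1; the value 1 comes from
    \<open>exp (log_f0 0) = 1\<close>.\<close>
  have F01: "fps_nth F 0 = 0" "fps_nth F (Suc 0) = 1" by (simp_all add: F_def K0)
  text \<open>Comparing coefficients in this differential equation gives a recurrence for the Taylor
    coefficients of \<open>f0\<close>.\<close>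
  have ode: "z * deriv f0 z * (exp z + 1) = 2 * exp z * f0 z" if z: "z \<in> unit_disc" for z
  proof -
    have "((\<lambda>w. w * exp (log_f0 w)) has_field_derivative
        1 * exp (log_f0 z) + (exp (log_f0 z) * deriv log_f0 z) * z) (at z)"
      by (intro DERIV_mult DERIV_ident DERIV_chain2[OF DERIV_exp]
          holomorphic_derivI[OF log_f0_holomorphic open_ball z])
    hence "deriv f0 z = 1 * exp (log_f0 z) + (exp (log_f0 z) * deriv log_f0 z) * z"
      unfolding f0_eq[abs_def] by (rule DERIV_imp_deriv)
    hence "z * deriv f0 z = f0 z * (1 + z * deriv log_f0 z)"
      by (simp add: f0_eq algebra_simps)
    also have "1 + z * deriv log_f0 z = sigmoid z" using log_f0_deriv[OF z] by simp
    finally have "z * deriv f0 z = f0 z * sigmoid z" .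
    moreover have "sigmoid z * (exp z + 1) = 2 * exp z"
    proof -
      have "1 + exp (-z) \<noteq> 0" using z by (intro one_plus_exp_nonzero) simp
      moreover have "exp z * (1 + exp (-z)) = exp z + 1" by (simp add: algebra_simps exp_minus)
      ultimately show ?thesis unfolding sigmoid_def by (metis mult.assoc mult.commute nonzero_eq_divide_eq)
    qed
    ultimately show ?thesis by (metis mult.assoc mult.commute)
  qed
  \<comment> \<open>The differential equation on a neighbourhood of 0 gives the same function a
    second expansion; uniqueness then makes it an identity of power series.\<close>
  have "(\<lambda>z. z * deriv f0 z * (exp z + 1)) has_fps_expansion fps_X * fps_deriv F * (fps_exp 1 + 1)"
    by (intro fps_expansion_intros F)
  moreover have "(\<lambda>z. z * deriv f0 z * (exp z + 1)) has_fps_expansion fps_const 2 * fps_exp 1 * F"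
  proof -
    have "(\<lambda>z. 2 * exp z * f0 z) has_fps_expansion fps_const 2 * fps_exp 1 * F"
      by (intro fps_expansion_intros F)
    moreover have "eventually (\<lambda>z. z * deriv f0 z * (exp z + 1) = 2 * exp z * f0 z) (nhds 0)"
      using eventually_nhds_in_open[of unit_disc 0] by (rule eventually_mono) (auto simp: ode)
    ultimately show ?thesis by (subst has_fps_expansion_cong) auto
  qed
  ultimately have "fps_X * fps_deriv F * (fps_exp 1 + 1) = fps_const 2 * fps_exp 1 * F"
    by (rule fps_expansion_unique_complex)
  hence eq: "fps_X * fps_deriv F * (fps_exp 1 + 1) = fps_const 2 * (F * fps_exp 1)"
    by (simp only: mult_ac)
  have "fps_nth (fps_X * fps_deriv F) i = of_nat i * fps_nth F i" for i
    by (cases i) auto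
  hence rec: "(\<Sum>i=0..n. of_nat i * fps_nth F i * fps_nth (fps_exp 1 + 1) (n - i)) =
      2 * (\<Sum>i=0..n. fps_nth F i * fps_nth (fps_exp 1) (n - i))" for n
    using arg_cong[OF eq, of "\<lambda>f. fps_nth f n"] unfolding fps_mult_left_const_nth
    by (simp only: fps_mult_nth[of _ "fps_exp 1 + 1"] fps_mult_nth[of _ "fps_exp 1"])
  have F2: "fps_nth F (Suc (Suc 0)) = 1 / 2"
    using rec[of "Suc (Suc 0)"] by (simp add: F01 fact_Suc field_simps)
  have F3: "fps_nth F (Suc (Suc (Suc 0))) = 1 / 8"
    using rec[of "Suc (Suc (Suc 0))"] by (simp add: F01 F2 fact_Suc field_simps)
  have F4: "fps_nth F (Suc (Suc (Suc (Suc 0)))) = 1 / 144"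
    using rec[of "Suc (Suc (Suc (Suc 0)))"] by (simp add: F01 F2 F3 fact_Suc field_simps)
  have "180 + fps_nth F (Suc (Suc (Suc (Suc (Suc 0))))) * 41472 = 0"
    using rec[of "Suc (Suc (Suc (Suc (Suc 0))))"] by (simp add: F01 F2 F3 F4 fact_Suc field_simps)
  hence "fps_nth F (Suc (Suc (Suc (Suc (Suc 0))))) * 41472 = - 180"
    by (simp only: eq_neg_iff_add_eq_0 add.commute)
  hence "fps_nth F (Suc (Suc (Suc (Suc (Suc 0))))) = - 180 / 41472"
    by (subst nonzero_eq_divide_eq) simp_all
  hence F5: "fps_nth F (Suc (Suc (Suc (Suc (Suc 0))))) = - 5 / 1152" by simp
  show ?thesis using F F01 F2 F3 F4 F5 by (auto simp: numeral_eq_Suc)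
qed

text \<open>The approximate value is read as an error below half a unit in the sixth decimal. The
  intermediate value theorem yields a root of the real equation, and strict monotonicity makes it
  the smallest positive one.\<close>

theorem theorem2p15:
  shows "(\<exists>F. f0 has_fps_expansion F \<and>
            fps_nth F 0 = 0 \<and> fps_nth F 1 = 1 \<and> fps_nth F 2 = 1 / 2 \<and>
            fps_nth F 3 = 1 / 8 \<and> fps_nth F 4 = 1 / 144 \<and> fps_nth F 5 = - 5 / 1152) \<and>
         (\<exists>r0::real.
            smallest_positive_root
              (\<lambda>r. 2 * tan (complex_of_real r / 2) * f0 (complex_of_real r) - 1) r0 \<and>
            \<bar>r0 - 0.799269\<bar> < 5 / 10 ^ 7 \<and>
            (\<forall>f\<in>class_S_SG. in_Omega_disc f r0))"
proof (rule conjI[OF f0_has_fps_expansion])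
  let ?\<Phi> = "\<lambda>r. 2 * tan (r / 2) * f0_real r"
  let ?a = "0.7992685 :: real" and ?b = "0.7992695 :: real"
  have cos_pos: "0 < cos (r / 2)" if "0 \<le> r" "r < 1" for r :: real
    using that pi_gt3 by (intro cos_gt_zero_pi) auto
  have "cos (r / 2) \<noteq> 0" if "r \<in> {?a..?b}" for r
    using that cos_pos[of r] by force
  hence "continuous_on {?a..?b} ?\<Phi>"
    unfolding f0_real_def
    by (intro continuous_intros continuous_on_subset[OF continuous_on_log_f0_real]) auto
  then obtain r0 where r0: "?a \<le> r0" "r0 \<le> ?b" "?\<Phi> r0 = 1"
    using IVT'[of ?\<Phi> ?a 1 ?b] two_tan_half_f0_real_less_1 two_tan_half_f0_real_greater_1 by force
  have "r0 \<noteq> ?a" "r0 \<noteq> ?b"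
    using r0(3) two_tan_half_f0_real_less_1 two_tan_half_f0_real_greater_1 by (metis less_irrefl)+
  hence strict: "?a < r0" "r0 < ?b" using r0 by linarith+
  \<comment> \<open>Both factors are nonnegative and strictly increasing. This serves twice: for
    minimality of the root and for the final estimate, where \<open>s = 0\<close> covers the centre
    of the disc.\<close>
  have less: "?\<Phi> s < 1" if s: "0 \<le> s" "s < r0" for s
  proof -
    have "tan (s / 2) < tan (r0 / 2)" using s r0 pi_gt3 by (intro tan_monotone) auto
    moreover have "0 \<le> tan (s / 2)" using s r0 pi_gt3 by (intro tan_pos_pi2_le) auto
    moreover have "f0_real s < f0_real r0" using s r0 by (intro f0_real_strict_mono) auto
    moreover have "0 \<le> f0_real s" using s by (simp add: f0_real_def)
    ultimately have "tan (s / 2) * f0_real s < tan (r0 / 2) * f0_real r0" by (intro mult_strict_mono') auto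
    thus ?thesis using r0(3) by simp
  qed
  \<comment> \<open>On \<open>[0, 1)\<close> the complex-valued root equation takes real values, so
    its zeros are the solutions of \<open>?\<Phi> r = 1\<close>.\<close>
  have cplx: "2 * tan (complex_of_real r / 2) * f0 (complex_of_real r) - 1 = of_real (?\<Phi> r - 1)"
    if "0 \<le> r" "r < 1" for r
    using tan_of_real[of "r / 2", where 'a = complex] f0_of_real[OF that] by simp
  have "smallest_positive_root
      (\<lambda>r. 2 * tan (complex_of_real r / 2) * f0 (complex_of_real r) - 1) r0"
    unfolding smallest_positive_root_def
  proof (intro conjI allI impI)
    show "0 < r0" using r0 by simp
    show "2 * tan (complex_of_real r0 / 2) * f0 (complex_of_real r0) - 1 = 0"
      using r0 by (subst cplx) auto
    fix s assume s: "0 < s \<and> s < r0"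
    hence "?\<Phi> s - 1 \<noteq> 0" using less[of s] by simp
    thus "2 * tan (complex_of_real s / 2) * f0 (complex_of_real s) - 1 \<noteq> 0"
      using s r0 by (subst cplx) (simp_all only: of_real_eq_0_iff, auto)
  qed
  moreover have "\<bar>r0 - 0.799269\<bar> < 5 / 10 ^ 7"
    using strict by (simp add: abs_if field_simps)
  moreover have "in_Omega_disc f r0" if "f \<in> class_S_SG" for f
    unfolding in_Omega_disc_def
  proof (intro allI impI)
    fix z :: complex assume z: "norm z < r0"
    have "norm (z * deriv f z - f z) \<le> f0_real (norm z) * tan (norm z / 2)"
      using z r0 by (intro norm_deriv_minus_le that) simp
    also have "\<dots> < 1 / 2" using less[of "norm z"] z by (simp add: field_simps)
    finally show "norm (z * deriv f z - f z) < 1 / 2" .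
  qed
  ultimately show "\<exists>r0. smallest_positive_root
      (\<lambda>r. 2 * tan (complex_of_real r / 2) * f0 (complex_of_real r) - 1) r0 \<and>
      \<bar>r0 - 0.799269\<bar> < 5 / 10 ^ 7 \<and> (\<forall>f\<in>class_S_SG. in_Omega_disc f r0)"
    by blast
qed

end
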